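(* (i) Assume that $Q$ is compact and all $\mathcal{P}_s$, $s\in S$, are convex and compact. If $\mathcal{R}_\Delta$ is overlap-connected for all $\Delta:S\to Q$, then the constant-gain robust Bellman equation $$u^*(s)=\sup_{\phi\in Q}\inf_{p_s\in\mathcal{P}_s}\sum_{a\in A}\sum_{s'\in S}\phi(a)p_s(s'|a)\big[r(s,a)-\alpha^*+u^*(s')\big]\qquad\forall s\in S$$ has a solution $(u^*,\alpha^* )$ with $u^*:S\to\mathbb{R}$, $\alpha^*\in[0,1]$. (ii) Assume that $\mathcal{P}_s$, $s\in S$, are compact and $Q$ is convex and compact. If $\mathcal{R}_p$ is overlap-connected for all $p\in\mathcal{P}$, then the constant-gain inf-sup equation $$u'(s)=\inf_{p_s\in\mathcal{P}_s}\sup_{\phi\in Q}\sum_{a\in A}\sum_{s'\in S}\phi(a)p_s(s'|a)\big[r(s,a)-\alpha'+u'(s')\big]\qquad\forall s\in S$$ has a solution $(u',\alpha')$ with $u':S\to\mathbb{R}$, $\alpha'\in[0,1]$.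
   Context: $S$ (states) and $A$ (actions) are finite nonempty sets; $\mathrm{Prob}(E)$ is the set of probability distributions on a finite set $E$; $r:S\times A\to[0,1]$ is a reward function. $Q\subseteq\mathrm{Prob}(A)$ is nonempty. For each $s\in S$, $\mathcal{P}_s$ is a nonempty set of maps $p_s:A\to\mathrm{Prob}(S)$, written $p_s(s'|a)$; $\mathcal{P}=\prod_{s\in S}\mathcal{P}_s$, and $p\in\mathcal{P}$ is written $p(s'|s,a)=p_s(s'|a)$. Compactness and convexity are as subsets of Euclidean space. For $p\in\mathcal{P}$ and $\Delta:S\to Q$ (written $\Delta(a|s)$), $p_\Delta(s'|s)=\sum_{a\in A}p(s'|s,a)\Delta(a|s)$. A closed communicating class of a Markov chain is a (nonempty) set of states that all communicate with each other and from which no state outside the set can be reached. For $\Delta:S\to Q$ and $p\in\mathcal{P}$, $$\mathcal{R}_\Delta=\{R\subseteq S:\exists p\in\mathcal{P}\text{ such that }R\text{ is a closed communicating class of }p_\Delta\},$$ $$\mathcal{R}_p=\{R\subseteq S:\exists\Delta:S\to Q\text{ such that }R\text{ is a closed communicating class of }p_\Delta\}.$$ A family $\mathcal{R}$ of subsets of $S$ (here $\mathcal{R}_\Delta$ or $\mathcal{R}_p$) is overlap-connected if for each $R,R'\in\mathcal{R}$ there exist an integer $k\ge1$ and $R_0,R_1,\dots,R_k\in\mathcal{R}$ with $R_0=R$, $R_k=R'$ and $R_i\cap R_{i+1}\ne\varnothing$ for all $0\le i\le k-1$. *)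

theory Defs
  imports "HOL-Analysis.Analysis"
begin

definition Prob :: "(real ^ 'e::finite) set" where
  "Prob = {q. (\<forall>e. 0 \<le> q $ e) \<and> (\<Sum>e\<in>UNIV. q $ e) = 1}"

text \<open>
  A map \<open>p\<^sub>s : A \<rightarrow> Prob(S)\<close> is an element of the Euclidean space \<open>real ^ 's ^ 'a\<close>,
  with \<open>p $ a $ s'\<close> standing for \<open>p\<^sub>s(s'|a)\<close>.
\<close>

definition Kernels :: "(real ^ 's::finite ^ 'a::finite) set" where
  "Kernels = {p. \<forall>a. p $ a \<in> Prob}"

definition controlled_chain ::
    "('s \<Rightarrow> real ^ 's::finite ^ 'a::finite) \<Rightarrow> ('s \<Rightarrow> real ^ 'a) \<Rightarrow> real ^ 's ^ 's" where
  "controlled_chain p \<Delta> = (\<chi> s s'. \<Sum>a\<in>UNIV. p s $ a $ s' * \<Delta> s $ a)"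

text \<open>
  Reachability in zero or more steps of positive probability. Allowing zero steps makes every
  state communicate with itself; this convention does not affect which sets are closed
  communicating classes of a stochastic matrix.
\<close>

definition reachable :: "real ^ 's::finite ^ 's \<Rightarrow> 's \<Rightarrow> 's \<Rightarrow> bool" where
  "reachable M = (\<lambda>s s'. 0 < M $ s $ s')\<^sup>*\<^sup>*"

definition communicate :: "real ^ 's::finite ^ 's \<Rightarrow> 's \<Rightarrow> 's \<Rightarrow> bool" where
  "communicate M s s' \<longleftrightarrow> reachable M s s' \<and> reachable M s' s"

definition closed_communicating_class :: "real ^ 's::finite ^ 's \<Rightarrow> 's set \<Rightarrow> bool" where
  "closed_communicating_class M R \<longleftrightarrow>
     R \<noteq> {} \<and> (\<forall>s\<in>R. \<forall>s'\<in>R. communicate M s s') \<and> (\<forall>s\<in>R. \<forall>s'. s' \<notin> R \<longrightarrow> \<not> reachable M s s')"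

definition classes_of_policy ::
    "('s \<Rightarrow> (real ^ 's::finite ^ 'a::finite) set) \<Rightarrow> ('s \<Rightarrow> real ^ 'a) \<Rightarrow> 's set set" where
  "classes_of_policy P \<Delta> =
     {R. \<exists>p\<in>Pi UNIV P. closed_communicating_class (controlled_chain p \<Delta>) R}"

definition classes_of_kernel ::
    "(real ^ 'a::finite) set \<Rightarrow> ('s \<Rightarrow> real ^ 's::finite ^ 'a) \<Rightarrow> 's set set" where
  "classes_of_kernel Q p =
     {R. \<exists>\<Delta>\<in>UNIV \<rightarrow> Q. closed_communicating_class (controlled_chain p \<Delta>) R}"

definition overlap_connected :: "'s set set \<Rightarrow> bool" where
  "overlap_connected \<R> \<longleftrightarrow>
     (\<forall>R\<in>\<R>. \<forall>R'\<in>\<R>. \<exists>k\<ge>1. \<exists>C :: nat \<Rightarrow> 's set.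
        (\<forall>i\<le>k. C i \<in> \<R>) \<and> C 0 = R \<and> C k = R' \<and> (\<forall>i<k. C i \<inter> C (i + 1) \<noteq> {}))"

end

theory Submission
  imports Defs
begin

text \<open>
  Both equations say that the dynamic programming operator \<open>T\<close> of a maxmin problem has an
  additive eigenvector, \<open>T u = u + \<alpha>\<close>. The proof lets a discount factor \<open>g\<close> tend to \<open>1\<close>:
  the fixed points \<open>h\<close> of \<open>h \<mapsto> T (g h)\<close>, shifted to have minimum \<open>0\<close>, converge along a
  subsequence to an eigenvector as soon as their spans stay bounded
  (\<open>topical_eigenvector\<close>).

  If the spans were unbounded, dividing by them would produce a nonconstant fixed point \<open>w\<close> of
  the recession operator \<open>T0\<close>, the operator of the same problem with reward \<open>0\<close>; compactness
  makes this quantitative (\<open>rigid_span_bound\<close>). So it suffices that every fixed point \<open>w\<close> of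
  \<open>T0\<close> is constant, and this is where overlap-connectedness enters. Fix an optimal policy \<open>x\<close>
  of the maximizer in \<open>w = T0 w\<close>. Then \<open>w\<close> is subharmonic for every answer of the minimizer
  and harmonic for an optimal answer \<open>y\<close>. By the maximum principle a subharmonic function is
  constant on each closed communicating class, and chains of overlapping classes force one common
  constant on all classes that answers to \<open>x\<close> can create. For the harmonic answer \<open>y\<close>, both
  the set where \<open>w\<close> is maximal and the set where it is minimal are absorbing, hence contain
  classes of \<open>y\<close>; so the maximum and the minimum of \<open>w\<close> agree
  (\<open>subharmonic_family_constant\<close>).

  The inf-sup equation is the sup-inf equation of the problem in which the players exchange
  roles and the reward \<open>r\<close> becomes \<open>1 - r\<close>: a solution \<open>(v, \<beta>)\<close> of the latter yields
  \<open>u = - v\<close> and \<open>\<alpha> = 1 - \<beta>\<close>.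
\<close>

section \<open>Topical operators\<close>

text \<open>
  Monotone and commuting with the addition of constants, which also makes the operator
  nonexpansive for the maximum norm. All three are folded into a single inequality, the form in
  which dynamic programming operators satisfy it and in which it gets used.
\<close>

definition topical :: "(real ^ 's::finite \<Rightarrow> real ^ 's) \<Rightarrow> bool" where
  "topical T \<longleftrightarrow> (\<forall>v w d. (\<forall>s. v $ s \<le> w $ s + d) \<longrightarrow> (\<forall>s. T v $ s \<le> T w $ s + d))"

lemma topicalD:
  assumes "topical T" "\<And>s. v $ s \<le> w $ s + d"
  shows "T v $ s \<le> T w $ s + d"
  using assms unfolding topical_def by blast

lemma topical_shift:
  assumes "topical T"
  shows "T (v + vec d) $ s = T v $ s + d"
proof (rule antisym)
  show "T (v + vec d) $ s \<le> T v $ s + d"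
    by (rule topicalD[OF assms]) simp
  have "T v $ s \<le> T (v + vec d) $ s + (- d)"
    by (rule topicalD[OF assms]) simp
  then show "T v $ s + d \<le> T (v + vec d) $ s" by simp
qed

lemma topical_continuous:
  assumes "topical T"
  shows "continuous_on UNIV T"
proof -
  have lip: "T v $ s \<le> T w $ s + dist v w" for v w s
  proof (rule topicalD[OF assms])
    fix t
    have "\<bar>(v - w) $ t\<bar> \<le> norm (v - w)" by (rule component_le_norm_cart)
    then show "v $ t \<le> w $ t + dist v w" by (simp add: dist_norm)
  qed
  have "continuous_on UNIV (\<lambda>v. T v $ s)" for s
    unfolding continuous_on_iff
  proof (intro ballI allI impI exI conjI)
    fix v w :: "real ^ 'a" and e :: real
    assume "0 < e" then show "0 < e" .
    assume "dist w v < e"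
    then show "dist (T w $ s) (T v $ s) < e"
      using lip[of v s w] lip[of w s v] by (simp add: dist_real_def dist_commute abs_if)
  qed
  then have "continuous_on UNIV (\<lambda>v. \<chi> s. T v $ s)"
    by (rule continuous_on_vec_lambda)
  then show ?thesis by simp
qed

text \<open>
  The box \<open>[0, 1 / (1 - g)]\<close> is mapped into itself because \<open>g / (1 - g) + 1 = 1 / (1 - g)\<close>, so
  Brouwer's theorem applies. The upper bound says that \<open>h\<close> grows at most like \<open>1 / (1 - g)\<close>,
  which keeps the approximate eigenvalue \<open>(1 - g) min h\<close> in \<open>[0, 1]\<close> as \<open>g\<close> tends to \<open>1\<close>.
\<close>

lemma discounted_fixed_point:
  fixes T :: "real ^ 's::finite \<Rightarrow> real ^ 's"
  assumes "topical T"
    and low: "\<And>s. 0 \<le> T 0 $ s" and upp: "\<And>s. T 0 $ s \<le> 1"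
    and g: "0 \<le> g" "g < 1"
  obtains h where "T (g *\<^sub>R h) = h" "\<And>s. 0 \<le> h $ s" "\<And>s. (1 - g) * h $ s \<le> 1"
proof -
  define M where "M = 1 / (1 - g)"
  have M: "g * M + 1 = M" "0 \<le> M" using g by (auto simp: M_def field_simps)
  have "continuous_on (cbox 0 (vec M)) (\<lambda>h. T (g *\<^sub>R h))"
    by (rule continuous_on_compose2[OF topical_continuous[OF assms(1)]])
       (auto intro!: continuous_intros)
  moreover have "(\<lambda>h. T (g *\<^sub>R h)) \<in> cbox 0 (vec M) \<rightarrow> cbox 0 (vec M)"
  proof (rule Pi_I)
    fix h :: "real ^ 's"
    assume "h \<in> cbox 0 (vec M)"
    then have h: "0 \<le> h $ s" "h $ s \<le> M" for s by (auto simp: mem_box_cart)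
    have "T 0 $ s \<le> T (g *\<^sub>R h) $ s + 0" for s
      by (rule topicalD[OF assms(1)]) (use g h in auto)
    moreover have "T (g *\<^sub>R h) $ s \<le> T 0 $ s + g * M" for s
      by (rule topicalD[OF assms(1)]) (use g h in \<open>auto intro: mult_left_mono\<close>)
    ultimately show "T (g *\<^sub>R h) \<in> cbox 0 (vec M)"
      using M low upp unfolding mem_box_cart by (smt (verit) vec_component zero_index)
  qed
  moreover have "cbox 0 (vec M :: real ^ 's) \<noteq> {}"
    using M by (simp add: interval_ne_empty_cart)
  ultimately obtain h :: "real ^ 's" where h: "h \<in> cbox 0 (vec M)" "T (g *\<^sub>R h) = h"
    using brouwer[of "cbox 0 (vec M)" "\<lambda>h. T (g *\<^sub>R h)"] by auto
  have "(1 - g) * h $ s \<le> 1" for s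
  proof -
    have "h $ s \<le> M" using h by (auto simp: mem_box_cart)
    then have "(1 - g) * h $ s \<le> (1 - g) * M" using g by (intro mult_left_mono) auto
    also have "\<dots> = 1" using g by (simp add: M_def)
    finally show ?thesis .
  qed
  with h show thesis by (intro that[of h]) (auto simp: mem_box_cart)
qed

text \<open>
  Approximate fixed points \<open>z\<close> with minimum \<open>0\<close> are bounded: on the compact set of vectors with
  minimum \<open>0\<close> and maximum \<open>1\<close> the defect of being fixed by \<open>T0\<close> is positive by rigidity, hence
  at least some \<open>e > 0\<close>, whereas by homogeneity the defect of \<open>z\<close> divided by its maximum \<open>L\<close>
  is at most a constant over \<open>L\<close>.
\<close>

lemma rigid_span_bound:
  fixes T0 :: "real ^ 's::finite \<Rightarrow> real ^ 's"
  assumes top: "topical T0"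
    and hom: "\<And>c v. 0 < c \<Longrightarrow> T0 (c *\<^sub>R v) = c *\<^sub>R T0 v"
    and rigid: "\<And>w s t. T0 w = w \<Longrightarrow> w $ s = w $ t"
  obtains B where "\<And>z s. (\<And>t. 0 \<le> z $ t) \<Longrightarrow> \<exists>t. z $ t = 0 \<Longrightarrow>
      (\<And>t. \<bar>T0 z $ t - z $ t\<bar> \<le> C) \<Longrightarrow> z $ s \<le> B"
proof -
  define K :: "(real ^ 's) set" where
    "K = cbox 0 (vec 1) \<inter> (\<Union>s. {w. w $ s = 0}) \<inter> (\<Union>s. {w. w $ s = 1})"
  define defect where "defect w = (\<Sum>t\<in>UNIV. \<bar>T0 w $ t - w $ t\<bar>)" for w
  have cK: "compact K" unfolding K_def
    by (intro compact_Int_closed compact_cbox closed_UN ballI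
        closed_Collect_eq continuous_intros) simp_all
  have cd: "continuous_on K defect" unfolding defect_def
    by (intro continuous_intros continuous_on_subset[OF topical_continuous[OF top]]) auto
  have pos: "0 < defect w" if wK: "w \<in> K" for w
  proof (rule ccontr)
    assume "\<not> 0 < defect w"
    then have "defect w = 0" unfolding defect_def by (smt (verit) sum_nonneg abs_ge_zero)
    then have "T0 w = w" by (simp add: defect_def sum_nonneg_eq_0_iff vec_eq_iff)
    then have "w $ s = w $ t" for s t by (rule rigid)
    moreover obtain s t where "w $ s = 0" "w $ t = 1"
      using wK unfolding K_def by blast
    ultimately show False by (metis zero_neq_one)
  qed
  obtain e where e: "0 < e" "\<And>w. w \<in> K \<Longrightarrow> e \<le> defect w"
  proof (cases "K = {}")
    case True
    then show thesis using that[of 1] by simp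
  next
    case False
    with cK cd obtain w
      where "w \<in> K" "\<forall>w'\<in>K. defect w \<le> defect w'"
      using continuous_attains_inf by blast
    then show thesis using that[of "defect w"] pos by blast
  qed
  have "z $ s \<le> real CARD('s) * C / e"
    if z: "\<And>t. 0 \<le> z $ t" "\<exists>t. z $ t = 0" and C: "\<And>t. \<bar>T0 z $ t - z $ t\<bar> \<le> C" for z s
  proof -
    define L where "L = Max (range (($) z))"
    have L: "z $ t \<le> L" for t unfolding L_def by simp
    obtain t1 where t1: "z $ t1 = L"
      using Max_in[of "range (($) z)"] unfolding L_def
      by (metis UNIV_not_empty empty_is_image finite_imageI finite rangeE)
    have C0: "0 \<le> C" using C[of s] by linarith
    show ?thesis
    proof (cases "L \<le> 0")
      case True
      then have "z $ s \<le> 0" using L[of s] by linarith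
      also have "0 \<le> real CARD('s) * C / e" using C0 e(1) by simp
      finally show ?thesis .
    next
      case False
      define w where "w = (1 / L) *\<^sub>R z"
      have "w \<in> K" using False z L t1 by (auto simp: w_def K_def mem_box_cart)
      then have "e \<le> defect w" by (rule e(2))
      also have "defect w = (\<Sum>t\<in>UNIV. \<bar>T0 z $ t - z $ t\<bar>) / L"
        unfolding defect_def sum_divide_distrib
        by (rule sum.cong) (use False in \<open>auto simp: w_def hom diff_divide_distrib[symmetric]\<close>)
      also have "\<dots> \<le> real CARD('s) * C / L"
      proof (rule divide_right_mono)
        show "(\<Sum>t\<in>UNIV. \<bar>T0 z $ t - z $ t\<bar>) \<le> real CARD('s) * C"
          by (rule sum_bounded_above) (rule C)
      qed (use False in simp)
      finally have "L \<le> real CARD('s) * C / e" using False e(1) by (simp add: field_simps)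
      with L[of s] show ?thesis by linarith
    qed
  qed
  then show thesis by (rule that)
qed

text \<open>
  Here \<open>T0\<close> plays the role of the recession operator \<open>lim T (c v) / c\<close> of \<open>T\<close>.
\<close>

lemma topical_eigenvector:
  fixes T T0 :: "real ^ 's::finite \<Rightarrow> real ^ 's"
  assumes top: "topical T" and top0: "topical T0"
    and hom: "\<And>c v. 0 < c \<Longrightarrow> T0 (c *\<^sub>R v) = c *\<^sub>R T0 v"
    and low: "\<And>v s. T0 v $ s \<le> T v $ s" and upp: "\<And>v s. T v $ s \<le> T0 v $ s + 1"
    and rigid: "\<And>w s t. T0 w = w \<Longrightarrow> w $ s = w $ t"
  obtains u \<alpha> where "\<alpha> \<in> {0..1}" "T u = u + vec \<alpha>"
proof -
  have "T0 0 = 2 *\<^sub>R T0 0" using hom[of 2 0] by simp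
  then have T00: "T0 0 = 0" by (simp add: vec_eq_iff)
  define g where "g n = 1 - 1 / real (Suc n)" for n
  have g: "0 \<le> g n" "g n < 1" for n by (auto simp: g_def field_simps)
  have glim: "g \<longlonglongrightarrow> 1"
    unfolding g_def using tendsto_diff[OF tendsto_const lim_1_over_n[THEN LIMSEQ_Suc]] 
    by (auto simp del: of_nat_Suc)
  \<comment> \<open>The discounted fixed point \<open>h\<close> is normalized to \<open>z = h - min h\<close>; its equation then
    carries the approximate eigenvalue \<open>a = (1 - g) min h\<close>.\<close>
  have "\<exists>z a. (\<forall>t. 0 \<le> z $ t) \<and> (\<exists>t. z $ t = 0) \<and> (\<forall>t. (1 - g n) * z $ t \<le> 1)
      \<and> 0 \<le> a \<and> a \<le> 1 \<and> T (g n *\<^sub>R z) = z + vec a" for n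
  proof -
    obtain h where h: "T (g n *\<^sub>R h) = h" "\<And>s. 0 \<le> h $ s" "\<And>s. (1 - g n) * h $ s \<le> 1"
      using discounted_fixed_point[OF top _ _ g] low[of 0] upp[of 0] T00 by auto
    define m where "m = Min (range (($) h))"
    have m: "m \<le> h $ t" for t unfolding m_def by simp
    obtain t0 where t0: "h $ t0 = m"
      using Min_in[of "range (($) h)"] unfolding m_def
      by (metis UNIV_not_empty empty_is_image finite_imageI finite rangeE)
    define z where "z = h - vec m"
    have "g n *\<^sub>R h = g n *\<^sub>R z + vec (g n * m)"
      by (simp add: vec_eq_iff z_def algebra_simps)
    then have "T (g n *\<^sub>R z) $ s + g n * m = h $ s" for s
      using h(1) topical_shift[OF top] by metis
    then have "T (g n *\<^sub>R z) = z + vec ((1 - g n) * m)"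
      by (simp add: vec_eq_iff z_def algebra_simps)
    moreover have "0 \<le> z $ t" "(1 - g n) * z $ t \<le> 1" for t
    proof -
      show "0 \<le> z $ t" using m[of t] by (simp add: z_def)
      have "0 \<le> m" using h(2) t0 by metis
      then have "(1 - g n) * z $ t \<le> (1 - g n) * h $ t"
        using g(2)[of n] by (intro mult_left_mono) (auto simp: z_def)
      with h(3)[of t] show "(1 - g n) * z $ t \<le> 1" by linarith
    qed
    moreover have "z $ t0 = 0" by (simp add: z_def t0)
    moreover have "0 \<le> (1 - g n) * m" "(1 - g n) * m \<le> 1"
      using h(2)[of t0] h(3)[of t0] t0 g(2)[of n] by auto
    ultimately show ?thesis by blast
  qed
  then obtain z a where z: "\<And>n t. 0 \<le> z n $ t" "\<And>n. \<exists>t. z n $ t = 0"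
      "\<And>n t. (1 - g n) * z n $ t \<le> 1"
    and a: "\<And>n. 0 \<le> a n" "\<And>n. a n \<le> 1"
    and eq: "\<And>n. T (g n *\<^sub>R z n) = z n + vec (a n)"
    by metis
  \<comment> \<open>As \<open>z - g z\<close> takes values in \<open>[0, 1]\<close>, so does \<open>T z - T (g z) = T z - z - a\<close>. Together
    with \<open>a\<close> and \<open>T z - T0 z\<close>, which also lie in \<open>[0, 1]\<close>, this bounds the defect uniformly in
    the discount factor.\<close>
  have gap: "\<bar>T0 (z n) $ t - z n $ t\<bar> \<le> 2" for n t
  proof -
    have "T (z n) $ t \<le> T (g n *\<^sub>R z n) $ t + 1"
      by (rule topicalD[OF top]) (use z(3)[of n] in \<open>simp add: algebra_simps\<close>)
    moreover have "T (g n *\<^sub>R z n) $ t \<le> T (z n) $ t + 0"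
      by (rule topicalD[OF top])
         (use z(1)[of n] g[of n] in \<open>simp add: mult_left_le_one_le\<close>)
    ultimately show ?thesis
      using eq[of n] a(1)[of n] a(2)[of n] low[of "z n" t] upp[of "z n" t]
      by (simp add: vec_eq_iff abs_if)
  qed
  obtain B where B: "\<And>n t. z n $ t \<le> B"
  proof (rule rigid_span_bound[OF top0 hom rigid, where C = 2])
    fix B
    assume "\<And>z s. (\<And>t. 0 \<le> z $ t) \<Longrightarrow> \<exists>t. z $ t = 0 \<Longrightarrow>
      (\<And>t. \<bar>T0 z $ t - z $ t\<bar> \<le> 2) \<Longrightarrow> z $ s \<le> B"
    then show thesis using that[of B] z(1,2) gap by blast
  qed
  have "compact (cbox 0 (vec B) \<times> {0..1::real} :: ((real ^ 's) \<times> real) set)"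
    by (intro compact_Times compact_cbox compact_Icc)
  moreover have "(z n, a n) \<in> cbox 0 (vec B) \<times> {0..1}" for n
    using z(1) B a by (auto simp: mem_box_cart)
  ultimately obtain l \<sigma> where l: "l \<in> cbox 0 (vec B) \<times> {0..1::real}" "strict_mono (\<sigma> :: nat \<Rightarrow> nat)"
      "((\<lambda>n. (z n, a n)) \<circ> \<sigma>) \<longlonglongrightarrow> l"
    by (metis (mono_tags, lifting) compact_imp_seq_compact seq_compactE)
  obtain u \<alpha> where u: "l = (u, \<alpha>)" by (cases l)
  have zu: "(\<lambda>n. z (\<sigma> n)) \<longlonglongrightarrow> u" and a\<alpha>: "(\<lambda>n. a (\<sigma> n)) \<longlonglongrightarrow> \<alpha>"
    using tendsto_fst[OF l(3)] tendsto_snd[OF l(3)] by (simp_all add: u o_def)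
  have g\<sigma>: "(\<lambda>n. g (\<sigma> n)) \<longlonglongrightarrow> 1"
    using LIMSEQ_subseq_LIMSEQ[OF glim l(2)] by (simp add: o_def)
  have "(\<lambda>n. g (\<sigma> n) *\<^sub>R z (\<sigma> n)) \<longlonglongrightarrow> u"
    using tendsto_scaleR[OF g\<sigma> zu] by simp
  then have "(\<lambda>n. T (g (\<sigma> n) *\<^sub>R z (\<sigma> n))) \<longlonglongrightarrow> T u"
    by (intro continuous_on_tendsto_compose[OF topical_continuous[OF top]]) auto
  moreover have "(\<lambda>n. z (\<sigma> n) + vec (a (\<sigma> n))) \<longlonglongrightarrow> u + vec \<alpha>"
    by (intro tendsto_intros zu) (auto intro!: vec_tendstoI a\<alpha>)
  ultimately have "T u = u + vec \<alpha>"
    unfolding eq by (rule LIMSEQ_unique)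
  then show thesis using l(1) u by (intro that[of \<alpha> u]) auto
qed

section \<open>Subharmonic functions and closed communicating classes\<close>

text \<open>
  The weighted gaps \<open>q(t) (m - f t)\<close> are nonnegative and have a nonpositive sum.
\<close>

lemma mean_at_maximum:
  fixes f :: "'s::finite \<Rightarrow> real"
  assumes q: "q \<in> Prob"
    and le: "\<And>t. 0 < q $ t \<Longrightarrow> f t \<le> m" and mean: "m \<le> (\<Sum>t\<in>UNIV. q $ t * f t)"
    and t: "0 < q $ t"
  shows "f t = m"
proof -
  have nn: "0 \<le> q $ i * (m - f i)" for i
  proof (cases "0 < q $ i")
    case True then show ?thesis using le[OF True] by simp
  next
    case False
    moreover have "0 \<le> q $ i" using q by (simp add: Prob_def)
    ultimately show ?thesis by simp
  qed
  have "(\<Sum>i\<in>UNIV. q $ i * (m - f i)) = (\<Sum>i\<in>UNIV. q $ i) * m - (\<Sum>i\<in>UNIV. q $ i * f i)"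
    by (simp add: right_diff_distrib sum_subtractf sum_distrib_right)
  also have "\<dots> \<le> 0" using q mean by (simp add: Prob_def)
  finally have "(\<Sum>i\<in>UNIV. q $ i * (m - f i)) = 0"
    by (intro order_antisym sum_nonneg nn)
  from iffD1[OF sum_nonneg_eq_0_iff[OF finite nn] this] have "q $ t * (m - f t) = 0" by blast
  with t show ?thesis by simp
qed

text \<open>
  The maximum principle: from a state of the class where \<open>w\<close> is maximal, maximality propagates
  along every transition, and the whole class is reachable.
\<close>

lemma subharmonic_constant_on_class:
  fixes M :: "real ^ 's::finite ^ 's"
  assumes M: "\<And>s. M $ s \<in> Prob" and R: "closed_communicating_class M R"
    and sub: "\<And>s. w s \<le> (\<Sum>t\<in>UNIV. M $ s $ t * w t)"
    and "s \<in> R" "t \<in> R"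
  shows "w s = w t"
proof -
  define m where "m = Max (w ` R)"
  have le: "w i \<le> m" if "i \<in> R" for i using that by (simp add: m_def)
  have "m \<in> w ` R"
    unfolding m_def using \<open>s \<in> R\<close> by (intro Max_in) auto
  then obtain i0 where i0: "i0 \<in> R" "w i0 = m" by blast
  have stay: "j \<in> R" if "i \<in> R" "0 < M $ i $ j" for i j
  proof -
    have "reachable M i j" unfolding reachable_def using that(2) by (rule r_into_rtranclp)
    then show ?thesis using R that(1) unfolding closed_communicating_class_def by meson
  qed
  have reach: "j \<in> R \<and> w j = m" if "reachable M i0 j" for j
    using that unfolding reachable_def
  proof (induction rule: rtranclp_induct)
    case base show ?case using i0 by simp
  next
    case (step i j)
    have i: "i \<in> R" "w i = m" using step.IH by auto
    have "w j = m"
    proof (rule mean_at_maximum[OF M])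
      show "m \<le> (\<Sum>t\<in>UNIV. M $ i $ t * w t)" using sub[of i] i by simp
      show "w k \<le> m" if "0 < M $ i $ k" for k using le stay i(1) that by blast
    qed (rule step.hyps)
    then show ?case using stay[OF i(1) step.hyps(2)] by simp
  qed
  have "reachable M i0 i" if "i \<in> R" for i
    using R i0(1) that by (simp add: closed_communicating_class_def communicate_def)
  then have "w i = m" if "i \<in> R" for i using reach that by blast
  then show ?thesis using assms(4,5) by simp
qed

text \<open>
  A minimal nonempty absorbing subset is a class, since the states reachable from any of its
  members form an absorbing subset of it and so exhaust it.
\<close>

lemma absorbing_set_contains_class:
  fixes M :: "real ^ 's::finite ^ 's"
  assumes "C \<noteq> {}" and closed: "\<And>s t. s \<in> C \<Longrightarrow> 0 < M $ s $ t \<Longrightarrow> t \<in> C"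
  obtains R where "R \<subseteq> C" "closed_communicating_class M R"
proof -
  define absorbing where
    "absorbing D \<longleftrightarrow> D \<noteq> {} \<and> (\<forall>s\<in>D. \<forall>t. 0 < M $ s $ t \<longrightarrow> t \<in> D)" for D
  have "C \<in> {D. absorbing D}" using assms by (auto simp: absorbing_def)
  then obtain R where R: "absorbing R" "R \<subseteq> C"
      and min: "\<And>D. absorbing D \<Longrightarrow> D \<subseteq> R \<Longrightarrow> D = R"
    using finite_has_minimal2[of "{D. absorbing D}" C] by auto
  have inside: "t \<in> R" if "reachable M s t" "s \<in> R" for s t
    using that(1) unfolding reachable_def
    by (induction rule: rtranclp_induct) (use R(1) \<open>s \<in> R\<close> in \<open>auto simp: absorbing_def\<close>)
  have reach: "{t. reachable M s t} = R" if "s \<in> R" for s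
  proof (rule min)
    show "absorbing {t. reachable M s t}"
      unfolding absorbing_def reachable_def by (auto intro: rtranclp.rtrancl_into_rtrancl)
  qed (use inside that in auto)
  have "R \<noteq> {}" using R(1) by (simp add: absorbing_def)
  then have "closed_communicating_class M R"
    unfolding closed_communicating_class_def communicate_def using reach by auto
  with R(2) show thesis by (rule that)
qed

lemma overlap_connected_imp_constant:
  fixes \<R> :: "'s set set"
  assumes conn: "overlap_connected \<R>"
    and const: "\<And>R s t. R \<in> \<R> \<Longrightarrow> s \<in> R \<Longrightarrow> t \<in> R \<Longrightarrow> w s = w t"
    and "R \<in> \<R>" "R' \<in> \<R>" "s \<in> R" "t \<in> R'"
  shows "w s = w t"
proof -
  obtain k :: nat and C :: "nat \<Rightarrow> 's set" where C: "\<And>i. i \<le> k \<Longrightarrow> C i \<in> \<R>" "C 0 = R" "C k = R'"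
      "\<And>i. i < k \<Longrightarrow> C i \<inter> C (i + 1) \<noteq> {}"
  proof -
    from conn[unfolded overlap_connected_def, rule_format, OF assms(3,4)]
    obtain k and C :: "nat \<Rightarrow> 's set"
      where "(\<forall>i\<le>k. C i \<in> \<R>) \<and> C 0 = R \<and> C k = R' \<and>
        (\<forall>i<k. C i \<inter> C (i + 1) \<noteq> {})"
      by (elim exE conjE) iprover
    then show thesis by (intro that[of k C]) auto
  qed
  have "i \<le> k \<Longrightarrow> \<forall>j\<in>C i. w j = w s" for i
  proof (induction i)
    case 0 then show ?case using const C(2) assms(3,5) by blast
  next
    case (Suc i)
    then obtain j where j: "j \<in> C i" "j \<in> C (Suc i)" using C(4)[of i] by auto
    then have "w j = w s" using Suc by simp
    then show ?case using const[OF C(1)[OF Suc.prems] _ j(2)] by simp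
  qed
  then show ?thesis using C(3) assms(6) by force
qed

text \<open>
  The rigidity statement behind the theorem. The index \<open>i\<close> ranges over the answers of the
  minimizing player to a fixed policy, and \<open>j\<close> is an optimal answer.
\<close>

lemma subharmonic_family_constant:
  fixes M :: "'i \<Rightarrow> real ^ 's::finite ^ 's"
  assumes M: "\<And>i s. i \<in> I \<Longrightarrow> M i $ s \<in> Prob"
    and conn: "overlap_connected {R. \<exists>i\<in>I. closed_communicating_class (M i) R}"
    and sub: "\<And>i s. i \<in> I \<Longrightarrow> w s \<le> (\<Sum>t\<in>UNIV. M i $ s $ t * w t)"
    and j: "j \<in> I" and harm: "\<And>s. (\<Sum>t\<in>UNIV. M j $ s $ t * w t) = w s"
  shows "w s = w t"
proof -
  let ?\<R> = "{R. \<exists>i\<in>I. closed_communicating_class (M i) R}"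
  \<comment> \<open>Stated for an arbitrary harmonic \<open>f\<close>, so that it also locates the minimum of \<open>w\<close> when
    it is applied to \<open>- w\<close>.\<close>
  have ext: "\<exists>R\<in>?\<R>. \<exists>b\<in>R. f b = Max (range f)"
    if "\<And>a. (\<Sum>t\<in>UNIV. M j $ a $ t * f t) = f a" for f :: "'s \<Rightarrow> real"
  proof -
    let ?C = "{a. f a = Max (range f)}"
    obtain R where R: "R \<subseteq> ?C" "closed_communicating_class (M j) R"
    proof (rule absorbing_set_contains_class[of ?C "M j"])
      have "Max (range f) \<in> range f" by (intro Max_in) auto
      then obtain a where "Max (range f) = f a" by blast
      then have "a \<in> ?C" by simp
      then show "?C \<noteq> {}" by blast
      show "b \<in> ?C" if "a \<in> ?C" "0 < M j $ a $ b" for a b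
        using mean_at_maximum[OF M[OF j], of a f "Max (range f)" b] that
          \<open>\<And>a. (\<Sum>t\<in>UNIV. M j $ a $ t * f t) = f a\<close> by simp
    qed
    moreover from R(2) obtain b where "b \<in> R"
      unfolding closed_communicating_class_def by blast
    ultimately show ?thesis using j by blast
  qed
  obtain R b where b: "R \<in> ?\<R>" "b \<in> R" "w b = Max (range w)"
    using ext[OF harm] by blast
  obtain R' c where c: "R' \<in> ?\<R>" "c \<in> R'" "- w c = Max (range (\<lambda>a. - w a))"
    using ext[of "\<lambda>a. - w a"] harm by (auto simp: sum_negf)
  have "w b = w c"
  proof (rule overlap_connected_imp_constant[OF conn _ b(1) c(1) b(2) c(2)])
    fix R s t assume R: "R \<in> ?\<R>" "s \<in> R" "t \<in> R"
    then obtain i where i: "i \<in> I" "closed_communicating_class (M i) R" by blast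
    show "w s = w t"
      by (rule subharmonic_constant_on_class[OF M[OF i(1)] i(2) sub[OF i(1)] R(2,3)])
  qed
  moreover have "w a \<le> w b" "w c \<le> w a" for a
  proof -
    show "w a \<le> w b" unfolding b(3) by simp
    have "- w a \<le> - w c" unfolding c(3) by simp
    then show "w c \<le> w a" by simp
  qed
  ultimately show ?thesis by (metis order_antisym)
qed

section \<open>Maxmin values\<close>

text \<open>
  The value of the sup-inf problem together with its attainment by both players. This
  characterizes the value by inequalities alone, so that comparison, uniqueness and scaling
  follow without any boundedness side conditions on suprema and infima.
\<close>

definition maxmin_value :: "'x set \<Rightarrow> 'y set \<Rightarrow> ('x \<Rightarrow> 'y \<Rightarrow> real) \<Rightarrow> real \<Rightarrow> bool" where
  "maxmin_value X Y f v \<longleftrightarrow>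
     (\<exists>x\<in>X. \<forall>y\<in>Y. v \<le> f x y) \<and> (\<forall>x\<in>X. \<exists>y\<in>Y. f x y \<le> v)"

lemma maxmin_value_mono:
  assumes "maxmin_value X Y f v" "maxmin_value X Y g w"
    and "\<And>x y. x \<in> X \<Longrightarrow> y \<in> Y \<Longrightarrow> f x y \<le> g x y + d"
  shows "v \<le> w + d"
  using assms unfolding maxmin_value_def by (meson add_le_cancel_right order_trans)

lemma maxmin_value_unique:
  assumes "maxmin_value X Y f v" "maxmin_value X Y f w"
  shows "v = w"
  using maxmin_value_mono[OF assms, of 0] maxmin_value_mono[OF assms(2,1), of 0] by simp

lemma maxmin_value_scale:
  assumes "maxmin_value X Y f v" "0 < (c::real)"
  shows "maxmin_value X Y (\<lambda>x y. c * f x y) (c * v)"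
  using assms unfolding maxmin_value_def by simp

lemma maxmin_value_cong:
  assumes "maxmin_value X Y f v" "\<And>x y. x \<in> X \<Longrightarrow> y \<in> Y \<Longrightarrow> f x y = g x y"
  shows "maxmin_value X Y g v"
  using assms unfolding maxmin_value_def by simp

text \<open>
  Separate continuity suffices because the infimum over \<open>Y\<close> is attained pointwise and, as an infimum
  of continuous functions, is upper semicontinuous in \<open>x\<close>, hence attains its supremum on the
  compact set \<open>X\<close>. The latter is argued with a maximizing sequence.
\<close>

lemma maxmin_value_SUP_INF:
  fixes X :: "'x::metric_space set" and Y :: "'y::metric_space set"
  assumes "compact X" "X \<noteq> {}" "compact Y" "Y \<noteq> {}"
    and contx: "\<And>y. y \<in> Y \<Longrightarrow> continuous_on X (\<lambda>x. f x y)"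
    and conty: "\<And>x. x \<in> X \<Longrightarrow> continuous_on Y (\<lambda>y. f x y)"
  shows "maxmin_value X Y f (SUP x\<in>X. INF y\<in>Y. f x y)"
proof -
  define h where "h x = (INF y\<in>Y. f x y)" for x
  have att: "\<exists>y\<in>Y. f x y = h x \<and> (\<forall>y'\<in>Y. h x \<le> f x y')" if x: "x \<in> X" for x
  proof -
    obtain y where "y \<in> Y" "\<forall>y'\<in>Y. f x y \<le> f x y'"
      using continuous_attains_inf[OF assms(3,4) conty[OF x]] by blast
    moreover from this have "h x = f x y"
      unfolding h_def by (intro cInf_eq_minimum) auto
    ultimately show ?thesis by auto
  qed
  obtain y0 where "y0 \<in> Y" using assms(4) by blast
  obtain b where "\<And>x. x \<in> X \<Longrightarrow> f x y0 \<le> b"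
    using continuous_attains_sup[OF assms(1,2) contx[OF \<open>y0 \<in> Y\<close>]] by blast
  then have "h x \<le> b" if "x \<in> X" for x
    using att[OF that] \<open>y0 \<in> Y\<close> that by (meson order_trans)
  then have bdd: "bdd_above (h ` X)" by (intro bdd_aboveI[of _ b]) auto
  define v where "v = (SUP x\<in>X. h x)"
  have hv: "h x \<le> v" if "x \<in> X" for x
    unfolding v_def by (rule cSUP_upper[OF that bdd])
  have "\<exists>x\<in>X. v - 1 / real (Suc n) < h x" for n
    using less_cSUP_iff[OF assms(2) bdd, of "v - 1 / real (Suc n)"] unfolding v_def by simp
  then obtain \<xi> where \<xi>: "\<And>n. \<xi> n \<in> X" "\<And>n. v - 1 / real (Suc n) < h (\<xi> n)" by metis
  obtain x \<sigma> where x: "x \<in> X" "strict_mono (\<sigma> :: nat \<Rightarrow> nat)" "(\<xi> \<circ> \<sigma>) \<longlonglongrightarrow> x"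
    using assms(1) \<xi>(1) by (metis compact_imp_seq_compact seq_compactE)
  have "v \<le> f x y" if "y \<in> Y" for y
  proof (rule LIMSEQ_le)
    show "(\<lambda>n. f (\<xi> (\<sigma> n)) y) \<longlonglongrightarrow> f x y"
      by (rule continuous_on_tendsto_compose[OF contx[OF that]]) (use x \<xi> in \<open>auto simp: o_def\<close>)
    have "(\<lambda>n. v - 1 / real (Suc n)) \<longlonglongrightarrow> v - 0"
      by (intro tendsto_diff tendsto_const lim_1_over_n[THEN LIMSEQ_Suc])
    from LIMSEQ_subseq_LIMSEQ[OF this x(2)]
    show "(\<lambda>n. v - 1 / real (Suc (\<sigma> n))) \<longlonglongrightarrow> v" by (simp add: o_def)
    have "v - 1 / real (Suc (\<sigma> n)) \<le> f (\<xi> (\<sigma> n)) y" for n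
      using \<xi>(2)[of "\<sigma> n"] att[OF \<xi>(1)[of "\<sigma> n"]] that by fastforce
    then show "\<exists>N. \<forall>n\<ge>N. v - 1 / real (Suc (\<sigma> n)) \<le> f (\<xi> (\<sigma> n)) y" by blast
  qed
  moreover have "\<exists>y\<in>Y. f x' y \<le> v" if "x' \<in> X" for x'
    using att[OF that] hv[OF that] by metis
  ultimately have "maxmin_value X Y f v" unfolding maxmin_value_def using x(1) by blast
  then show ?thesis unfolding v_def h_def .
qed

section \<open>The constant-gain equation of a maxmin problem\<close>

lemma Prob_mean_mono:
  assumes "q \<in> Prob" "\<And>t. v $ t \<le> w $ t + d"
  shows "(\<Sum>t\<in>UNIV. q $ t * v $ t) \<le> (\<Sum>t\<in>UNIV. q $ t * w $ t) + d"
proof -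
  have "(\<Sum>t\<in>UNIV. q $ t * v $ t) \<le> (\<Sum>t\<in>UNIV. q $ t * (w $ t + d))"
    using assms by (intro sum_mono mult_left_mono) (auto simp: Prob_def)
  also have "\<dots> = (\<Sum>t\<in>UNIV. q $ t * w $ t) + (\<Sum>t\<in>UNIV. q $ t) * d"
    by (simp add: distrib_left sum.distrib sum_distrib_right)
  finally show ?thesis using assms(1) by (simp add: Prob_def)
qed

text \<open>
  The game-theoretic form common to both parts of the corollary: \<open>x\<close> is the move of the
  maximizer, \<open>y\<close> the answer of the minimizer, and every policy of the maximizer is required to
  have overlap-connected classes.
\<close>

theorem constant_gain_maxmin:
  fixes X :: "'s::finite \<Rightarrow> 'x::metric_space set" and Y :: "'s \<Rightarrow> 'y::metric_space set"
    and c :: "'s \<Rightarrow> 'x \<Rightarrow> 'y \<Rightarrow> real" and q :: "'s \<Rightarrow> 'x \<Rightarrow> 'y \<Rightarrow> real ^ 's"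
  assumes X: "\<And>s. compact (X s)" "\<And>s. X s \<noteq> {}" and Y: "\<And>s. compact (Y s)" "\<And>s. Y s \<noteq> {}"
    and c: "\<And>s x y. x \<in> X s \<Longrightarrow> y \<in> Y s \<Longrightarrow> c s x y \<in> {0..1}"
    and q: "\<And>s x y. x \<in> X s \<Longrightarrow> y \<in> Y s \<Longrightarrow> q s x y \<in> Prob"
    and cx: "\<And>s y. y \<in> Y s \<Longrightarrow> continuous_on (X s) (\<lambda>x. c s x y)"
    and cy: "\<And>s x. x \<in> X s \<Longrightarrow> continuous_on (Y s) (\<lambda>y. c s x y)"
    and qx: "\<And>s y. y \<in> Y s \<Longrightarrow> continuous_on (X s) (\<lambda>x. q s x y)"
    and qy: "\<And>s x. x \<in> X s \<Longrightarrow> continuous_on (Y s) (\<lambda>y. q s x y)"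
    and conn: "\<And>x. x \<in> Pi UNIV X \<Longrightarrow>
      overlap_connected {R. \<exists>y\<in>Pi UNIV Y. closed_communicating_class (\<chi> s. q s (x s) (y s)) R}"
  obtains u \<alpha> where "\<alpha> \<in> {0..1}"
    "\<And>s. u s = (SUP x\<in>X s. INF y\<in>Y s. c s x y - \<alpha> + (\<Sum>t\<in>UNIV. q s x y $ t * u t))"
proof -
  \<comment> \<open>The factor \<open>\<delta>\<close> treats the dynamic programming operator (\<open>\<delta> = 1\<close>) and its recession
    operator (\<open>\<delta> = 0\<close>) at once.\<close>
  define f where "f \<delta> v s x y = \<delta> * c s x y + (\<Sum>t\<in>UNIV. q s x y $ t * v $ t)"
    for \<delta> :: real and v :: "real ^ 's" and s x y
  define T where "T \<delta> v = (\<chi> s. SUP x\<in>X s. INF y\<in>Y s. f \<delta> v s x y)" for \<delta> v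
  have T: "maxmin_value (X s) (Y s) (f \<delta> v s) (T \<delta> v $ s)" for \<delta> v s
    unfolding T_def vec_lambda_beta f_def
    by (rule maxmin_value_SUP_INF) (auto intro!: X Y continuous_intros cx cy qx qy)
  have top: "topical (T \<delta>)" for \<delta>
    unfolding topical_def
  proof (intro allI impI)
    fix v w :: "real ^ 's" and d s
    assume vw: "\<forall>s. v $ s \<le> w $ s + d"
    show "T \<delta> v $ s \<le> T \<delta> w $ s + d"
    proof (rule maxmin_value_mono[OF T T])
      fix x y assume "x \<in> X s" "y \<in> Y s"
      then show "f \<delta> v s x y \<le> f \<delta> w s x y + d"
        unfolding f_def using Prob_mean_mono[OF q, of x s y v w d] vw by simp
    qed
  qed
  obtain u \<alpha> where u: "\<alpha> \<in> {0..1}" "T 1 u = u + vec \<alpha>"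
  proof (rule topical_eigenvector[OF top[of 1] top[of 0]])
    fix k :: real and v :: "real ^ 's"
    assume "0 < k"
    have "T 0 (k *\<^sub>R v) $ s = k * T 0 v $ s" for s
    proof -
      have v: "maxmin_value (X s) (Y s) (f 0 (k *\<^sub>R v) s) (k * T 0 v $ s)"
        by (rule maxmin_value_cong[OF maxmin_value_scale[OF T \<open>0 < k\<close>]])
           (simp add: f_def sum_distrib_left mult.left_commute)
      show ?thesis by (rule maxmin_value_unique[OF T v])
    qed
    then show "T 0 (k *\<^sub>R v) = k *\<^sub>R T 0 v" by (simp add: vec_eq_iff)
  next
    fix v s
    show "T 0 v $ s \<le> T 1 v $ s"
      using maxmin_value_mono[OF T T, of s 0 v 1 v 0] c by (simp add: f_def)
    show "T 1 v $ s \<le> T 0 v $ s + 1"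
      using maxmin_value_mono[OF T T, of s 1 v 0 v 1] c by (simp add: f_def)
  next
    fix w s t
    assume "T 0 w = w"
    then have w: "maxmin_value (X s) (Y s) (\<lambda>x y. \<Sum>t\<in>UNIV. q s x y $ t * w $ t) (w $ s)" for s
      using T[of s 0 w] by (simp add: f_def[abs_def])
    then have "\<forall>s. \<exists>x\<in>X s. \<forall>y\<in>Y s. w $ s \<le> (\<Sum>t\<in>UNIV. q s x y $ t * w $ t)"
      unfolding maxmin_value_def by blast
    then obtain x where x: "\<And>s. x s \<in> X s"
        "\<And>s y. y \<in> Y s \<Longrightarrow> w $ s \<le> (\<Sum>t\<in>UNIV. q s (x s) y $ t * w $ t)"
      by metis
    have "\<forall>s. \<exists>y\<in>Y s. (\<Sum>t\<in>UNIV. q s (x s) y $ t * w $ t) \<le> w $ s"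
      using w x(1) unfolding maxmin_value_def by blast
    then obtain y where y: "\<And>s. y s \<in> Y s"
        "\<And>s. (\<Sum>t\<in>UNIV. q s (x s) (y s) $ t * w $ t) \<le> w $ s"
      by metis
    show "w $ s = w $ t"
    proof (rule subharmonic_family_constant[where I = "Pi UNIV Y"
            and M = "\<lambda>y. \<chi> s. q s (x s) (y s)" and w = "\<lambda>s. w $ s" and j = y])
      show "overlap_connected
          {R. \<exists>y\<in>Pi UNIV Y. closed_communicating_class (\<chi> s. q s (x s) (y s)) R}"
        by (rule conn) (use x in auto)
    qed (use x y q in \<open>auto simp: Pi_iff intro!: order_antisym\<close>)
  qed
  have "u $ s = (SUP x\<in>X s. INF y\<in>Y s. c s x y - \<alpha> + (\<Sum>t\<in>UNIV. q s x y $ t * u $ t))" for s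
  proof -
    let ?f = "\<lambda>x y. c s x y - \<alpha> + (\<Sum>t\<in>UNIV. q s x y $ t * u $ t)"
    have v: "maxmin_value (X s) (Y s) ?f (SUP x\<in>X s. INF y\<in>Y s. ?f x y)"
      by (rule maxmin_value_SUP_INF) (auto intro!: X Y continuous_intros cx cy qx qy)
    have "T 1 u $ s \<le> (SUP x\<in>X s. INF y\<in>Y s. ?f x y) + \<alpha>"
      by (rule maxmin_value_mono[OF T v]) (simp add: f_def)
    moreover have "(SUP x\<in>X s. INF y\<in>Y s. ?f x y) \<le> T 1 u $ s + (- \<alpha>)"
      by (rule maxmin_value_mono[OF v T]) (simp add: f_def)
    ultimately show ?thesis using u(2) by (simp add: vec_eq_iff)
  qed
  then show thesis using that[of \<alpha> "\<lambda>s. u $ s"] u(1) by blast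
qed

section \<open>Robust Markov decision processes\<close>

definition transition :: "real ^ 'a::finite \<Rightarrow> real ^ 's::finite ^ 'a \<Rightarrow> real ^ 's" where
  "transition \<phi> p = (\<chi> t. \<Sum>a\<in>UNIV. p $ a $ t * \<phi> $ a)"

lemma controlled_chain_transition:
  "controlled_chain p \<Delta> = (\<chi> s. transition (\<Delta> s) (p s))"
  by (simp add: controlled_chain_def transition_def vec_eq_iff)

lemma transition_Prob:
  fixes p :: "real ^ 's::finite ^ 'a::finite"
  assumes "\<phi> \<in> Prob" "p \<in> Kernels"
  shows "transition \<phi> p \<in> Prob"
proof -
  have p: "0 \<le> p $ a $ t" "(\<Sum>t\<in>UNIV. p $ a $ t) = 1" for a t
    using assms(2) by (auto simp: Kernels_def Prob_def)
  have "(\<Sum>t\<in>UNIV. \<Sum>a\<in>UNIV. p $ a $ t * \<phi> $ a) = (\<Sum>a\<in>UNIV. \<Sum>t\<in>UNIV. p $ a $ t * \<phi> $ a)"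
    by (rule sum.swap)
  also have "\<dots> = 1" using assms(1) by (simp add: sum_distrib_right[symmetric] p Prob_def)
  finally show ?thesis
    using assms(1) p by (auto simp: transition_def Prob_def intro!: sum_nonneg)
qed

lemma continuous_on_transition:
  "continuous_on A (\<lambda>\<phi>. transition \<phi> p)" "continuous_on B (\<lambda>p. transition \<phi> p)"
  unfolding transition_def by (intro continuous_intros)+

lemma mean_reward_bounds:
  assumes "\<And>a. r a \<in> {0..1::real}" "\<phi> \<in> Prob"
  shows "(\<Sum>a\<in>UNIV. \<phi> $ a * r a) \<in> {0..1}"
proof -
  have "(\<Sum>a\<in>UNIV. \<phi> $ a * r a) \<le> (\<Sum>a\<in>UNIV. \<phi> $ a * 1)"
    using assms by (intro sum_mono mult_left_mono) (auto simp: Prob_def)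
  moreover have "0 \<le> (\<Sum>a\<in>UNIV. \<phi> $ a * r a)"
    using assms by (intro sum_nonneg mult_nonneg_nonneg) (auto simp: Prob_def)
  ultimately show ?thesis using assms(2) by (simp add: Prob_def)
qed

text \<open>
  Since the weights \<open>\<phi>(a) p(t|a)\<close> sum to \<open>1\<close>, the gain \<open>\<alpha>\<close> can be pulled out of the double
  sum.
\<close>

lemma bellman_integrand:
  fixes p :: "real ^ 's::finite ^ 'a::finite"
  assumes "\<phi> \<in> Prob" "p \<in> Kernels"
  shows "(\<Sum>a\<in>UNIV. \<Sum>t\<in>UNIV. \<phi> $ a * p $ a $ t * (r a - \<alpha> + u t)) =
    (\<Sum>a\<in>UNIV. \<phi> $ a * r a) - \<alpha> + (\<Sum>t\<in>UNIV. transition \<phi> p $ t * u t)"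
proof -
  have p: "(\<Sum>t\<in>UNIV. p $ a $ t) = 1" for a
    using assms(2) by (auto simp: Kernels_def Prob_def)
  have "(\<Sum>t\<in>UNIV. \<phi> $ a * p $ a $ t * (r a - \<alpha> + u t)) =
      \<phi> $ a * r a - \<phi> $ a * \<alpha> + (\<Sum>t\<in>UNIV. p $ a $ t * \<phi> $ a * u t)" for a
  proof -
    have "(\<Sum>t\<in>UNIV. \<phi> $ a * p $ a $ t * (r a - \<alpha> + u t)) =
        (\<Sum>t\<in>UNIV. p $ a $ t) * (\<phi> $ a * (r a - \<alpha>)) + (\<Sum>t\<in>UNIV. p $ a $ t * \<phi> $ a * u t)"
      unfolding sum_distrib_right sum.distrib[symmetric]
      by (rule sum.cong) (simp_all add: algebra_simps)
    then show ?thesis by (simp add: p algebra_simps)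
  qed
  then have "(\<Sum>a\<in>UNIV. \<Sum>t\<in>UNIV. \<phi> $ a * p $ a $ t * (r a - \<alpha> + u t)) =
      (\<Sum>a\<in>UNIV. \<phi> $ a * r a) - (\<Sum>a\<in>UNIV. \<phi> $ a) * \<alpha> +
      (\<Sum>a\<in>UNIV. \<Sum>t\<in>UNIV. p $ a $ t * \<phi> $ a * u t)"
    by (simp add: sum.distrib sum_subtractf sum_distrib_right)
  also have "(\<Sum>a\<in>UNIV. \<Sum>t\<in>UNIV. p $ a $ t * \<phi> $ a * u t) =
      (\<Sum>t\<in>UNIV. transition \<phi> p $ t * u t)"
    by (subst sum.swap) (simp add: transition_def sum_distrib_right)
  finally show ?thesis using assms(1) by (simp add: Prob_def)
qed

lemma uminus_SUP_INF:
  fixes f :: "'x \<Rightarrow> 'y \<Rightarrow> real"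
  shows "- (SUP x\<in>X. INF y\<in>Y. f x y) = (INF x\<in>X. SUP y\<in>Y. - f x y)"
  by (simp add: Inf_real_def image_image)

theorem corollary7p3:
  fixes r :: "'s::finite \<Rightarrow> 'a::finite \<Rightarrow> real"
    and Q :: "(real ^ 'a) set"
    and P :: "'s \<Rightarrow> (real ^ 's ^ 'a) set"
  assumes r_range: "\<And>s a. r s a \<in> {0..1}"
    and Q_nonempty: "Q \<noteq> {}" and Q_prob: "Q \<subseteq> Prob"
    and P_nonempty: "\<And>s. P s \<noteq> {}" and P_kernels: "\<And>s. P s \<subseteq> Kernels"
  shows
    "(compact Q \<longrightarrow>
      (\<forall>s. convex (P s) \<and> compact (P s)) \<longrightarrow>
      (\<forall>\<Delta>\<in>UNIV \<rightarrow> Q. overlap_connected (classes_of_policy P \<Delta>)) \<longrightarrow>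
      (\<exists>u :: 's \<Rightarrow> real. \<exists>\<alpha>\<in>{0..1}. \<forall>s.
         u s = (SUP \<phi>\<in>Q. INF p\<in>P s.
                  \<Sum>a\<in>UNIV. \<Sum>s'\<in>UNIV. \<phi> $ a * p $ a $ s' * (r s a - \<alpha> + u s'))))
     \<and>
     ((\<forall>s. compact (P s)) \<longrightarrow>
      convex Q \<and> compact Q \<longrightarrow>
      (\<forall>p\<in>Pi UNIV P. overlap_connected (classes_of_kernel Q p)) \<longrightarrow>
      (\<exists>u :: 's \<Rightarrow> real. \<exists>\<alpha>\<in>{0..1}. \<forall>s.
         u s = (INF p\<in>P s. SUP \<phi>\<in>Q.
                  \<Sum>a\<in>UNIV. \<Sum>s'\<in>UNIV. \<phi> $ a * p $ a $ s' * (r s a - \<alpha> + u s'))))"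
proof (intro conjI impI)
  note trans = transition_Prob[OF subsetD[OF Q_prob] subsetD[OF P_kernels]]
  have rew: "(\<Sum>a\<in>UNIV. \<phi> $ a * r s a) \<in> {0..1}" if "\<phi> \<in> Q" for s \<phi>
    by (rule mean_reward_bounds) (use r_range Q_prob that in blast)+
  note integrand = bellman_integrand[OF subsetD[OF Q_prob] subsetD[OF P_kernels]]
  {
    assume Q: "compact Q" and P: "\<forall>s. convex (P s) \<and> compact (P s)"
      and conn: "\<forall>\<Delta>\<in>UNIV \<rightarrow> Q. overlap_connected (classes_of_policy P \<Delta>)"
    obtain u \<alpha> where \<alpha>: "\<alpha> \<in> {0..1}" and u: "\<And>s. u s = (SUP \<phi>\<in>Q. INF p\<in>P s.
        (\<Sum>a\<in>UNIV. \<phi> $ a * r s a) - \<alpha> + (\<Sum>t\<in>UNIV. transition \<phi> p $ t * u t))"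
    proof (rule constant_gain_maxmin[where X = "\<lambda>_. Q" and Y = P
          and c = "\<lambda>s \<phi> p. \<Sum>a\<in>UNIV. \<phi> $ a * r s a" and q = "\<lambda>s. transition"])
      fix x assume "x \<in> Pi UNIV (\<lambda>_::'s. Q)"
      then show "overlap_connected
          {R. \<exists>p\<in>Pi UNIV P. closed_communicating_class (\<chi> s. transition (x s) (p s)) R}"
        using conn by (simp add: classes_of_policy_def controlled_chain_transition)
    next
      fix s \<phi> p assume "\<phi> \<in> Q" "p \<in> P s"
      then show "transition \<phi> p \<in> Prob" by (rule trans)
      show "(\<Sum>a\<in>UNIV. \<phi> $ a * r s a) \<in> {0..1}" by (rule rew) fact
    qed ((rule that; assumption) | simp add: Q P Q_nonempty P_nonempty continuous_on_transition
        continuous_on_const continuous_on_diff continuous_on_sum continuous_on_mult_right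
        continuous_on_component)+
    then show "\<exists>u :: 's \<Rightarrow> real. \<exists>\<alpha>\<in>{0..1}. \<forall>s.
         u s = (SUP \<phi>\<in>Q. INF p\<in>P s.
                  \<Sum>a\<in>UNIV. \<Sum>s'\<in>UNIV. \<phi> $ a * p $ a $ s' * (r s a - \<alpha> + u s'))"
    proof (intro exI[of _ u] bexI[of _ \<alpha>] allI)
      show "u s = (SUP \<phi>\<in>Q. INF p\<in>P s.
          \<Sum>a\<in>UNIV. \<Sum>s'\<in>UNIV. \<phi> $ a * p $ a $ s' * (r s a - \<alpha> + u s'))" for s
        by (subst u, intro SUP_cong INF_cong refl) (rule integrand[symmetric])
    qed (rule \<alpha>)
  }
  {
    assume P: "\<forall>s. compact (P s)" and Q: "convex Q \<and> compact Q"
      and conn: "\<forall>p\<in>Pi UNIV P. overlap_connected (classes_of_kernel Q p)"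
    obtain v \<beta> where \<beta>: "\<beta> \<in> {0..1}" and v: "\<And>s. v s = (SUP p\<in>P s. INF \<phi>\<in>Q.
        (1 - (\<Sum>a\<in>UNIV. \<phi> $ a * r s a)) - \<beta> + (\<Sum>t\<in>UNIV. transition \<phi> p $ t * v t))"
    proof (rule constant_gain_maxmin[where X = P and Y = "\<lambda>_. Q"
          and c = "\<lambda>s p \<phi>. 1 - (\<Sum>a\<in>UNIV. \<phi> $ a * r s a)" and q = "\<lambda>s p \<phi>. transition \<phi> p"])
      fix p assume "p \<in> Pi UNIV P"
      then show "overlap_connected
          {R. \<exists>\<Delta>\<in>UNIV \<rightarrow> Q. closed_communicating_class (\<chi> s. transition (\<Delta> s) (p s)) R}"
        using conn by (simp add: classes_of_kernel_def controlled_chain_transition)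
    next
      fix s p \<phi> assume *: "p \<in> P s" "\<phi> \<in> Q"
      show "1 - (\<Sum>a\<in>UNIV. \<phi> $ a * r s a) \<in> {0..1}" using rew[OF *(2), of s] by simp
      show "transition \<phi> p \<in> Prob" by (rule trans[OF *(2,1)])
    qed ((rule that; assumption) | simp add: Q P Q_nonempty P_nonempty continuous_on_transition
        continuous_on_const continuous_on_diff continuous_on_sum continuous_on_mult_right
        continuous_on_component)+
    have eq: "- v s = (INF p\<in>P s. SUP \<phi>\<in>Q. \<Sum>a\<in>UNIV. \<Sum>t\<in>UNIV.
        \<phi> $ a * p $ a $ t * (r s a - (1 - \<beta>) + - v t))" for s
    proof -
      have "- v s = (INF p\<in>P s. SUP \<phi>\<in>Q. - ((1 - (\<Sum>a\<in>UNIV. \<phi> $ a * r s a)) - \<beta>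
          + (\<Sum>t\<in>UNIV. transition \<phi> p $ t * v t)))"
        by (subst v) (rule uminus_SUP_INF)
      also have "\<dots> = (INF p\<in>P s. SUP \<phi>\<in>Q. \<Sum>a\<in>UNIV. \<Sum>t\<in>UNIV.
          \<phi> $ a * p $ a $ t * (r s a - (1 - \<beta>) + - v t))"
      proof (intro INF_cong SUP_cong refl)
        fix p \<phi> assume "p \<in> P s" "\<phi> \<in> Q"
        then show "- ((1 - (\<Sum>a\<in>UNIV. \<phi> $ a * r s a)) - \<beta>
            + (\<Sum>t\<in>UNIV. transition \<phi> p $ t * v t)) =
          (\<Sum>a\<in>UNIV. \<Sum>t\<in>UNIV. \<phi> $ a * p $ a $ t * (r s a - (1 - \<beta>) + - v t))"
          by (subst integrand) (simp_all add: sum_negf)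
      qed
      finally show ?thesis .
    qed
    have "1 - \<beta> \<in> {0..1}" using \<beta> by simp
    then show "\<exists>u :: 's \<Rightarrow> real. \<exists>\<alpha>\<in>{0..1}. \<forall>s.
         u s = (INF p\<in>P s. SUP \<phi>\<in>Q.
                  \<Sum>a\<in>UNIV. \<Sum>s'\<in>UNIV. \<phi> $ a * p $ a $ s' * (r s a - \<alpha> + u s'))"
      using \<open>1 - \<beta> \<in> {0..1}\<close>
      by (intro exI[of _ "\<lambda>s. - v s"] bexI[of _ "1 - \<beta>"] allI eq)
  }
qed

end
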